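(* Let $\Lambda>0$. For $0<v_0<1$ and $0\le\alpha<1$, we have $$\frac{(2(1+\alpha)\Lambda)^{1/2}}{1-\alpha}v_0^{\frac{1-\alpha}{2}}<R(v_0)<\frac{2\Lambda^{1/2}A(\alpha)}{1-\alpha}\,\frac{v_0^{\frac{1-\alpha}{2}}}{1-v_0},\qquad A(\alpha)=\frac{2^{3/2}}{(1+\alpha)^{1/2}},$$ where $R(v_0)$ is the time to proceed from $\big(v_0,-\frac{c(v_0)}{\Lambda}(1-v_0)\big)$ to the origin along the stable manifold of $X_{c(v_0)}$.
   Context: $X_c$ ($c\ge0$) is the vector field on $Q=\{(x,y):x\ge0,\ y\le0\}$ with differential system $x'=y$, $y'=\frac1\Lambda(cy+x^\alpha)$. There is a unique (nonconstant) orbit of $X_c$ in $Q$ tending to the origin in positive time; it is the graph over $(0,+\infty)$ of a function $y_c$, analytic and negative for $x>0$, continuous at $0$ with $y_c(0)=0$, and is called the stable manifold of $X_c$. For $0<v_0<1$, $c(v_0)$ is the unique value of $c$ such that $y_{c}(v_0)=-\frac{c}{\Lambda}(1-v_0)$. The time is $R(v_0)=\int_0^{v_0}\frac{ds}{|y_{c(v_0)}(s)|}$. *)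

theory Defs
  imports "HOL-Analysis.Analysis"
begin

text \<open>The power \<open>x\<^sup>\<alpha>\<close> for \<open>x \<ge> 0\<close>, \<open>\<alpha> \<ge> 0\<close>, with the convention \<open>0\<^sup>0 = 1\<close>, so that the vector
  field below is continuous on the whole quadrant also for \<open>\<alpha> = 0\<close> (the library has \<open>0 powr 0 = 0\<close>).\<close>

definition rpow :: "real \<Rightarrow> real \<Rightarrow> real" where
  "rpow x \<alpha> = (if \<alpha> = 0 then 1 else x powr \<alpha>)"

definition vfield :: "real \<Rightarrow> real \<Rightarrow> real \<Rightarrow> real \<times> real \<Rightarrow> real \<times> real" where
  "vfield \<Lambda> \<alpha> c = (\<lambda>(x, y). (y, (1 / \<Lambda>) * (c * y + rpow x \<alpha>)))"

definition quadrant :: "(real \<times> real) set" where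
  "quadrant = {(x, y). x \<ge> 0 \<and> y \<le> 0}"

text \<open>The time interval need not be open, since trajectories can enter and leave the closed
  quadrant through its boundary.\<close>

definition trajectory_in_quadrant ::
  "real \<Rightarrow> real \<Rightarrow> real \<Rightarrow> real set \<Rightarrow> (real \<Rightarrow> real \<times> real) \<Rightarrow> bool" where
  "trajectory_in_quadrant \<Lambda> \<alpha> c I \<gamma> \<longleftrightarrow>
     is_interval I \<and> I \<noteq> {} \<and>
     (\<forall>t\<in>I. \<gamma> t \<in> quadrant \<and> (\<gamma> has_vector_derivative vfield \<Lambda> \<alpha> c (\<gamma> t)) (at t within I))"

definition maximal_trajectory ::
  "real \<Rightarrow> real \<Rightarrow> real \<Rightarrow> real set \<Rightarrow> (real \<Rightarrow> real \<times> real) \<Rightarrow> bool" where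
  "maximal_trajectory \<Lambda> \<alpha> c I \<gamma> \<longleftrightarrow>
     trajectory_in_quadrant \<Lambda> \<alpha> c I \<gamma> \<and>
     (\<forall>J \<delta>. trajectory_in_quadrant \<Lambda> \<alpha> c J \<delta> \<and> I \<subseteq> J \<and> (\<forall>t\<in>I. \<delta> t = \<gamma> t) \<longrightarrow> J = I)"

text \<open>Convergence to the origin as the time increases in \<open>I\<close>. This covers all cases: \<open>I\<close> unbounded
  above (limit at infinity), \<open>I\<close> with a finite open right end (left limit there), and \<open>I\<close> with a
  largest element (the origin is attained there).\<close>

definition tends_to_origin :: "real set \<Rightarrow> (real \<Rightarrow> real \<times> real) \<Rightarrow> bool" where
  "tends_to_origin I \<gamma> \<longleftrightarrow> (\<forall>\<epsilon>>0. \<exists>t0\<in>I. \<forall>t\<in>I. t0 \<le> t \<longrightarrow> norm (\<gamma> t) < \<epsilon>)"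

definition orbit_to_origin :: "real \<Rightarrow> real \<Rightarrow> real \<Rightarrow> (real \<times> real) set \<Rightarrow> bool" where
  "orbit_to_origin \<Lambda> \<alpha> c S \<longleftrightarrow>
     (\<exists>I \<gamma>. maximal_trajectory \<Lambda> \<alpha> c I \<gamma> \<and> \<not> \<gamma> constant_on I \<and>
            tends_to_origin I \<gamma> \<and> S = \<gamma> ` I)"

text \<open>The function \<open>y\<^sub>c\<close> whose graph over \<open>(0, \<infinity>)\<close> is the stable manifold. The origin is removed
  from the orbit because it is reached in finite time, and hence lies on the maximal trajectory,
  exactly when \<open>\<alpha> < 1\<close>.\<close>

definition is_stable_manifold_fun ::
  "real \<Rightarrow> real \<Rightarrow> real \<Rightarrow> (real \<Rightarrow> real) \<Rightarrow> bool" where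
  "is_stable_manifold_fun \<Lambda> \<alpha> c y \<longleftrightarrow>
     y 0 = 0 \<and>
     (\<exists>S. orbit_to_origin \<Lambda> \<alpha> c S \<and> S - {(0, 0)} = {(x, y x) |x. x > 0})"

definition travel_time :: "(real \<Rightarrow> real) \<Rightarrow> real \<Rightarrow> real" where
  "travel_time y v0 = integral {0..v0} (\<lambda>s. 1 / \<bar>y s\<bar>)"

definition A_const :: "real \<Rightarrow> real" where
  "A_const \<alpha> = 2 powr (3/2) / (1 + \<alpha>) powr (1/2)"

end

theory Submission
  imports Defs
begin

text \<open>Along the stable manifold \<open>(y\<^sup>2)' = 2 (c y + x\<^sup>\<alpha>) / \<Lambda>\<close>. Dropping the term \<open>c y < 0\<close> gives
  \<open>y\<^sup>2 < 2 x\<^sup>1\<^sup>+\<^sup>\<alpha> / ((1 + \<alpha>) \<Lambda>)\<close>, hence the lower bound for the time; at \<open>x = v0\<close> it also bounds \<open>c\<close>.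
  With this bound on \<open>c\<close>, the curve \<open>y\<^sup>2 = k\<^sup>2 x\<^sup>1\<^sup>+\<^sup>\<alpha>\<close> with \<open>k\<^sup>2 = (1 - v0)\<^sup>2 (1 + \<alpha>) / (4 \<Lambda>)\<close>
  is a barrier on \<open>[0, v0]\<close>: the function \<open>y\<^sup>2 - k\<^sup>2 x\<^sup>1\<^sup>+\<^sup>\<alpha>\<close> increases wherever it is negative,
  so it never becomes negative.\<close>

section \<open>Half powers and a comparison principle on an interval\<close>

lemma powr_half_square: "(x powr (a / 2))\<^sup>2 = x powr a" for x a :: real
  by (simp add: power2_eq_square powr_add[symmetric])

text \<open>After the last time \<open>u\<close> before \<open>x\<close> with
  \<open>0 \<le> g u\<close>, the function is negative, hence increasing, so \<open>g x\<close>
  would exceed \<open>g u\<close>. The derivative is controlled only where \<open>g\<close> is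
  negative because the barrier estimate gives its sign only there.\<close>

lemma nonneg_if_increasing_where_negative:
  fixes g :: "real \<Rightarrow> real"
  assumes cont: "continuous_on {a..b} g" and a: "0 \<le> g a"
    and deriv: "\<And>x. a < x \<Longrightarrow> x < b \<Longrightarrow> g x < 0 \<Longrightarrow> \<exists>D. (g has_real_derivative D) (at x) \<and> 0 < D"
    and x: "x \<in> {a..b}"
  shows "0 \<le> g x"
proof (rule ccontr)
  assume neg: "\<not> 0 \<le> g x"
  define S where "S = {t \<in> {a..x}. 0 \<le> g t}"
  have contx: "continuous_on {a..x} g"
    using cont x by (auto intro: continuous_on_subset)
  have "closed S"
    unfolding S_def by (intro continuous_on_closed_Collect_le contx) auto
  moreover have "bounded S"
    by (rule bounded_subset[of "{a..x}"]) (auto simp: S_def)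
  ultimately have "compact S"
    by (simp add: compact_eq_bounded_closed)
  moreover have "a \<in> S"
    using a x by (simp add: S_def)
  ultimately obtain u where u: "u \<in> S" "\<And>t. t \<in> S \<Longrightarrow> t \<le> u"
    using compact_attains_sup[of S] by blast
  then have ux: "a \<le> u" "u < x" "0 \<le> g u"
    using neg by (auto simp: S_def less_le)
  have "g u < g x"
  proof (rule DERIV_pos_imp_increasing_open[OF \<open>u < x\<close>])
    fix t assume t: "u < t" "t < x"
    then have "t \<notin> S"
      using u(2) by fastforce
    then have "g t < 0"
      using t ux by (auto simp: S_def)
    then show "\<exists>D. (g has_real_derivative D) (at t) \<and> 0 < D"
      using deriv t ux x by auto
  qed (use contx ux in \<open>auto intro: continuous_on_subset\<close>)
  then show False
    using ux neg by simp
qed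

section \<open>Geometry of a trajectory whose orbit is a graph ending at the origin\<close>

locale orbit_graph =
  fixes \<Lambda> \<alpha> c :: real and I :: "real set" and \<gamma> :: "real \<Rightarrow> real \<times> real" and y :: "real \<Rightarrow> real"
  assumes Lambda: "0 < \<Lambda>"
    and traj: "trajectory_in_quadrant \<Lambda> \<alpha> c I \<gamma>"
    and to_origin: "tends_to_origin I \<gamma>"
    and graph: "\<gamma> ` I - {(0, 0)} = {(x, y x) |x. x > 0}"
begin

lemma segment_subset: "s \<in> I \<Longrightarrow> t \<in> I \<Longrightarrow> {s..t} \<subseteq> I"
  using traj by (meson atLeastAtMost_iff mem_is_interval_1_I subsetI trajectory_in_quadrant_def)

lemma in_quadrant: "t \<in> I \<Longrightarrow> 0 \<le> fst (\<gamma> t) \<and> snd (\<gamma> t) \<le> 0"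
  using traj by (force simp: trajectory_in_quadrant_def quadrant_def case_prod_beta)

lemma deriv_gamma:
  "t \<in> I \<Longrightarrow> (\<gamma> has_vector_derivative vfield \<Lambda> \<alpha> c (\<gamma> t)) (at t within I)"
  using traj by (simp add: trajectory_in_quadrant_def)

lemma deriv_fst:
  assumes "t \<in> I"
  shows "((\<lambda>t. fst (\<gamma> t)) has_real_derivative snd (\<gamma> t)) (at t within I)"
  using bounded_linear.has_vector_derivative[OF bounded_linear_fst deriv_gamma[OF assms]]
  by (simp add: vfield_def case_prod_beta has_real_derivative_iff_has_vector_derivative)

lemma deriv_snd:
  assumes "t \<in> I"
  shows "((\<lambda>t. snd (\<gamma> t)) has_real_derivative (c * snd (\<gamma> t) + rpow (fst (\<gamma> t)) \<alpha>) / \<Lambda>)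
    (at t within I)"
  using bounded_linear.has_vector_derivative[OF bounded_linear_snd deriv_gamma[OF assms]]
  by (simp add: vfield_def case_prod_beta has_real_derivative_iff_has_vector_derivative)

lemma continuous_gamma: "continuous_on I \<gamma>"
  using deriv_gamma by (meson continuous_on_eq_continuous_within has_vector_derivative_continuous)

text \<open>The interval \<open>I\<close> may contain its end points, where derivatives are
  one-sided; strictly between two of its times they are two-sided.\<close>

lemma at_within_between:
  assumes "s \<in> I" "t \<in> I" "s < r" "r < t"
  shows "at r within I = at r"
proof -
  have "{s<..<t} \<subseteq> interior I"
    by (rule interior_maximal) (use segment_subset[OF assms(1,2)] in auto)
  then show ?thesis
    using assms by (intro at_within_interior) auto
qed

text \<open>In the quadrant \<open>x' = y \<le> 0\<close>.\<close>

lemma fst_antimono: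
  assumes "s \<in> I" "t \<in> I" "s \<le> t"
  shows "fst (\<gamma> t) \<le> fst (\<gamma> s)"
proof (rule DERIV_nonpos_imp_decreasing_open[OF \<open>s \<le> t\<close>])
  fix r assume r: "s < r" "r < t"
  then have "r \<in> I"
    using segment_subset[OF assms(1,2)] by auto
  then show "\<exists>D. ((\<lambda>t. fst (\<gamma> t)) has_real_derivative D) (at r) \<and> D \<le> 0"
    using deriv_fst in_quadrant at_within_between[OF assms(1,2) r] by metis
next
  have "{s..t} \<subseteq> I"
    using segment_subset[OF assms(1,2)] by auto
  then show "continuous_on {s..t} (\<lambda>t. fst (\<gamma> t))"
    using continuous_gamma by (intro continuous_on_fst) (rule continuous_on_subset)
qed

lemma graph_point:
  assumes "0 < x"
  shows "\<exists>t\<in>I. fst (\<gamma> t) = x \<and> snd (\<gamma> t) = y x"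
proof -
  have "(x, y x) \<in> \<gamma> ` I"
    using assms graph by auto
  then show ?thesis
    by (metis fst_conv imageE snd_conv)
qed

text \<open>The graph has no point over \<open>x = 0\<close>, so only the removed origin
  remains.\<close>

lemma fst_zero:
  assumes "t \<in> I" "fst (\<gamma> t) = 0"
  shows "\<gamma> t = (0, 0)"
proof (rule ccontr)
  assume "\<gamma> t \<noteq> (0, 0)"
  then have "\<gamma> t \<in> {(x, y x) |x. x > 0}"
    using assms graph by blast
  then show False
    using assms by auto
qed

text \<open>The vector field points out of the quadrant along the positive \<open>x\<close>-axis.\<close>

lemma snd_neg:
  assumes t: "t \<in> I" "0 < fst (\<gamma> t)"
  shows "snd (\<gamma> t) < 0"
proof (rule ccontr)
  assume "\<not> snd (\<gamma> t) < 0"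
  then have zero: "snd (\<gamma> t) = 0"
    using in_quadrant[OF t(1)] by simp
  \<comment> \<open>The right-hand derivative at \<open>t\<close> is of use only if \<open>I\<close>
    continues beyond \<open>t\<close>. Since the trajectory must come closer to the origin than
    \<open>\<gamma> t\<close>, there is a later time \<open>t0\<close> in \<open>I\<close>.\<close>
  have "0 < norm (\<gamma> t)"
    using t by auto
  then obtain t0 where t0: "t0 \<in> I" "\<And>s. s \<in> I \<Longrightarrow> t0 \<le> s \<Longrightarrow> norm (\<gamma> s) < norm (\<gamma> t)"
    using to_origin unfolding tends_to_origin_def by blast
  then have "t < t0"
    using t(1) by (meson less_irrefl not_less)
  have "0 < (c * snd (\<gamma> t) + rpow (fst (\<gamma> t)) \<alpha>) / \<Lambda>"
    using zero t Lambda by (simp add: rpow_def)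
  then obtain d where d: "0 < d"
    "\<And>h. 0 < h \<Longrightarrow> t + h \<in> I \<Longrightarrow> h < d \<Longrightarrow> snd (\<gamma> t) < snd (\<gamma> (t + h))"
    using has_real_derivative_pos_inc_right[OF deriv_snd[OF t(1)]] by blast
  define h where "h = min (d / 2) (t0 - t)"
  have h: "0 < h" "h < d" "t + h \<le> t0"
    using d(1) \<open>t < t0\<close> by (auto simp: h_def)
  then have "t + h \<in> I"
    using segment_subset[OF t(1) t0(1)] by auto
  then show False
    using d(2)[of h] h zero in_quadrant[of "t + h"] by auto
qed

lemma neg: "0 < x \<Longrightarrow> y x < 0"
  by (metis graph_point snd_neg)

text \<open>Up to time \<open>t\<close> the abscissa stays at least \<open>fst (\<gamma> t)\<close>,
  hence positive, so \<open>x' = y < 0\<close> there.\<close>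

lemma fst_strict_antimono:
  assumes "s \<in> I" "t \<in> I" "s < t" "0 < fst (\<gamma> t)"
  shows "fst (\<gamma> t) < fst (\<gamma> s)"
proof (rule DERIV_neg_imp_decreasing_open[OF \<open>s < t\<close>])
  fix r assume r: "s < r" "r < t"
  then have "r \<in> I"
    using segment_subset[OF assms(1,2)] by auto
  moreover have "0 < fst (\<gamma> r)"
    using fst_antimono[OF \<open>r \<in> I\<close> assms(2)] r assms(4) by auto
  ultimately show "\<exists>D. ((\<lambda>t. fst (\<gamma> t)) has_real_derivative D) (at r) \<and> D < 0"
    using deriv_fst snd_neg at_within_between[OF assms(1,2) r] by metis
next
  have "{s..t} \<subseteq> I"
    using segment_subset[OF assms(1,2)] by auto
  then show "continuous_on {s..t} (\<lambda>t. fst (\<gamma> t))"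
    using continuous_gamma by (intro continuous_on_fst) (rule continuous_on_subset)
qed

lemma fst_less_imp:
  assumes "s \<in> I" "t \<in> I" "fst (\<gamma> t) < fst (\<gamma> s)"
  shows "s < t"
  using fst_antimono[OF assms(2,1)] assms(3) by force

section \<open>The abscissa as a coordinate in place of time\<close>

definition positive_times :: "real set" where
  "positive_times = {t \<in> I. 0 < fst (\<gamma> t)}"

text \<open>The graph lies over the whole half-line, so a larger and a smaller positive abscissa are
  attained too, by monotonicity before and after \<open>t\<close>. This makes the set open even if
  \<open>I\<close> is not.\<close>

lemma positive_times_between:
  assumes "t \<in> positive_times"
  obtains r s where "r \<in> positive_times" "s \<in> positive_times" "r < t" "t < s"
proof -
  have t: "t \<in> I" "0 < fst (\<gamma> t)"
    using assms by (auto simp: positive_times_def)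
  obtain r where r: "r \<in> I" "fst (\<gamma> r) = fst (\<gamma> t) + 1"
    using graph_point[of "fst (\<gamma> t) + 1"] t by force
  obtain s where s: "s \<in> I" "fst (\<gamma> s) = fst (\<gamma> t) / 2"
    using graph_point[of "fst (\<gamma> t) / 2"] t by force
  show thesis
  proof (rule that)
    show "r < t"
      using fst_less_imp[of r t] r t by simp
    show "t < s"
      using fst_less_imp[of t s] s t by simp
  qed (use r s t in \<open>auto simp: positive_times_def\<close>)
qed

lemma positive_times_convex:
  assumes "r \<in> positive_times" "s \<in> positive_times" "r \<le> t" "t \<le> s"
  shows "t \<in> positive_times"
  using assms segment_subset[of r s] fst_antimono[of t s] by (force simp: positive_times_def)

lemma open_positive_times: "open positive_times"
proof (rule openI)
  fix t assume "t \<in> positive_times"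
  then obtain r s where "r \<in> positive_times" "s \<in> positive_times" "r < t" "t < s"
    by (rule positive_times_between)
  then have "ball t (min (t - r) (s - t)) \<subseteq> positive_times"
    using positive_times_convex[of r s] by (auto simp: dist_real_def)
  then show "\<exists>e>0. ball t e \<subseteq> positive_times"
    using \<open>r < t\<close> \<open>t < s\<close> by (intro exI[of _ "min (t - r) (s - t)"]) simp
qed

lemma inj_fst: "inj_on (\<lambda>t. fst (\<gamma> t)) positive_times"
proof (rule linorder_inj_onI)
  fix s t assume "s < t" "s \<in> positive_times" "t \<in> positive_times"
  then show "fst (\<gamma> s) \<noteq> fst (\<gamma> t)"
    using fst_strict_antimono[of s t] by (simp add: positive_times_def)
qed auto

text \<open>This is \<open>dy/dx = y'/x'\<close>. The abscissa has nonzero derivative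
  \<open>y x\<close> in time, so its inverse \<open>g\<close> has derivative \<open>1 / y x\<close>,
  and the chain rule applies to \<open>snd (\<gamma> (g x))\<close>.\<close>

lemma deriv_y:
  assumes x: "0 < x"
  shows "(y has_real_derivative (c * y x + rpow x \<alpha>) / (\<Lambda> * y x)) (at x)"
proof -
  obtain t where t: "t \<in> I" "fst (\<gamma> t) = x" "snd (\<gamma> t) = y x"
    using graph_point[OF x] by blast
  have tp: "t \<in> positive_times"
    using t x by (simp add: positive_times_def)
  have sub: "positive_times \<subseteq> I"
    by (auto simp: positive_times_def)
  have at: "at t within I = at t"
    using tp sub open_positive_times by (meson at_within_open_subset)
  define g where "g = inv_into positive_times (\<lambda>t. fst (\<gamma> t))"
  have gt: "g (fst (\<gamma> s)) = s" if "s \<in> positive_times" for s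
    using inv_into_f_f[OF inj_fst that] by (simp add: g_def)
  have "(g has_derivative (*) (inverse (y x))) (at (fst (\<gamma> t)))"
  proof (rule has_derivative_inverse_strong[OF open_positive_times tp])
    show "continuous_on positive_times (\<lambda>t. fst (\<gamma> t))"
      using continuous_gamma sub by (intro continuous_on_fst) (rule continuous_on_subset)
    show "((\<lambda>t. fst (\<gamma> t)) has_derivative (*) (y x)) (at t)"
      using deriv_fst[OF t(1)] t at by (simp add: has_field_derivative_def)
    show "(*) (y x) \<circ> (*) (inverse (y x)) = id"
      using neg[OF x] by (auto simp: fun_eq_iff)
  qed (use gt in auto)
  then have dg: "(g has_real_derivative inverse (y x)) (at x)"
    by (simp add: has_field_derivative_def t)
  have "((\<lambda>t. snd (\<gamma> t)) has_real_derivative (c * y x + rpow x \<alpha>) / \<Lambda>) (at (g x))"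
    using deriv_snd[OF t(1)] t at gt[OF tp] by simp
  from DERIV_chain2[OF this dg]
  have "((\<lambda>x. snd (\<gamma> (g x))) has_real_derivative (c * y x + rpow x \<alpha>) / (\<Lambda> * y x)) (at x)"
    by (simp add: field_simps)
  \<comment> \<open>By injectivity, any time at which the abscissa is \<open>z\<close> equals
    \<open>g z\<close>.\<close>
  moreover have "snd (\<gamma> (g z)) = y z" if z: "z \<in> {0<..}" for z
  proof -
    obtain s where "s \<in> I" "fst (\<gamma> s) = z" "snd (\<gamma> s) = y z"
      using graph_point[of z] z by auto
    then show ?thesis
      using gt[of s] z by (auto simp: positive_times_def)
  qed
  ultimately show ?thesis
    using x has_field_derivative_transform_within_open[of _ _ x "{0<..}" y] by auto
qed

text \<open>When the origin is reached in finite time, the time \<open>t0\<close> in \<open>tends_to_origin\<close> may lie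
  beyond the arrival, so that closeness to the origin has to be read off from \<open>x\<close> by compactness
  of the time interval before \<open>t0\<close>.\<close>

lemma tendsto_0: "(y \<longlongrightarrow> 0) (at_right 0)"
proof (rule tendstoI)
  fix e :: real assume "0 < e"
  then obtain t0 where t0: "t0 \<in> I" "\<And>t. t \<in> I \<Longrightarrow> t0 \<le> t \<Longrightarrow> norm (\<gamma> t) < e"
    using to_origin unfolding tends_to_origin_def by blast
  \<comment> \<open>The value 1 is an arbitrary cut-off: points with abscissa below it are visited
    after \<open>t1\<close>, so before \<open>t0\<close> only the compact interval
    \<open>{t1..t0}\<close> matters.\<close>
  obtain t1 where t1: "t1 \<in> I" "fst (\<gamma> t1) = 1"
    using graph_point[of 1] by auto
  have sub: "{t1..t0} \<subseteq> I"
    using segment_subset t0(1) t1(1) by blast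
  have cont: "continuous_on {t1..t0} \<gamma>"
    using continuous_gamma sub by (rule continuous_on_subset)
  define K where "K = {t \<in> {t1..t0}. e \<le> norm (\<gamma> t)}"
  have "closed K"
    unfolding K_def by (intro continuous_on_closed_Collect_le continuous_intros cont)
  moreover have "bounded K"
    by (rule bounded_subset[of "{t1..t0}"]) (auto simp: K_def)
  ultimately have K: "compact K"
    by (simp add: compact_eq_bounded_closed)
  have pos: "0 < fst (\<gamma> t)" if "t \<in> K" for t
  proof -
    have t: "t \<in> I" "e \<le> norm (\<gamma> t)"
      using that sub by (auto simp: K_def)
    then have "\<gamma> t \<noteq> (0, 0)"
      using \<open>0 < e\<close> by auto
    then show ?thesis
      using fst_zero[OF t(1)] in_quadrant[OF t(1)] by fastforce
  qed
  \<comment> \<open>The minimum of the abscissa over \<open>K\<close>, or any positive number if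
    \<open>K\<close> is empty. An abscissa below \<open>d\<close> then rules out times in
    \<open>K\<close>.\<close>
  obtain d where d: "0 < d" "\<And>t. t \<in> K \<Longrightarrow> d \<le> fst (\<gamma> t)"
  proof (cases "K = {}")
    case True
    then show thesis
      using that[of 1] by simp
  next
    case False
    have "continuous_on K (\<lambda>t. fst (\<gamma> t))"
      by (intro continuous_on_fst continuous_on_subset[OF cont]) (auto simp: K_def)
    then obtain k where "k \<in> K" "\<And>t. t \<in> K \<Longrightarrow> fst (\<gamma> k) \<le> fst (\<gamma> t)"
      using continuous_attains_inf[OF K False] by blast
    then show thesis
      using that[of "fst (\<gamma> k)"] pos by blast
  qed
  have "dist (y x) 0 < e" if x: "0 < x" "x < min d 1" for x
  proof -
    obtain t where t: "t \<in> I" "fst (\<gamma> t) = x" "snd (\<gamma> t) = y x"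
      using graph_point[OF x(1)] by blast
    have "t1 < t"
      using fst_less_imp[OF t1(1) t(1)] t t1 x by simp
    have "norm (\<gamma> t) < e"
    proof (cases "t0 \<le> t")
      case False
      then show ?thesis
        using d(2)[of t] t x \<open>t1 < t\<close> by (force simp: K_def)
    qed (use t0 t in auto)
    moreover have "norm (snd (\<gamma> t)) \<le> norm (\<gamma> t)"
      by (metis norm_snd_le prod.collapse)
    ultimately show ?thesis
      using t by simp
  qed
  then show "\<forall>\<^sub>F x in at_right 0. dist (y x) 0 < e"
    unfolding eventually_at_right_field using d(1) by (intro exI[of _ "min d 1"]) auto
qed

end

section \<open>Bounds for the square of the stable manifold function\<close>

locale stable_manifold =
  fixes \<Lambda> \<alpha> c :: real and y :: "real \<Rightarrow> real"
  assumes Lambda: "0 < \<Lambda>" and alpha: "0 \<le> \<alpha>" "\<alpha> < 1" and c: "0 \<le> c"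
    and manifold: "is_stable_manifold_fun \<Lambda> \<alpha> c y"
begin

lemma zero: "y 0 = 0"
  using manifold by (simp add: is_stable_manifold_fun_def)

lemma ex_orbit_graph: "\<exists>I \<gamma>. orbit_graph \<Lambda> \<alpha> c I \<gamma> y"
proof -
  obtain I \<gamma> where "maximal_trajectory \<Lambda> \<alpha> c I \<gamma>" "tends_to_origin I \<gamma>"
    "\<gamma> ` I - {(0, 0)} = {(x, y x) |x. x > 0}"
    using manifold unfolding is_stable_manifold_fun_def orbit_to_origin_def by blast
  then have "orbit_graph \<Lambda> \<alpha> c I \<gamma> y"
    using Lambda by unfold_locales (auto simp: maximal_trajectory_def)
  then show ?thesis
    by blast
qed

lemma neg: "0 < x \<Longrightarrow> y x < 0"
  using ex_orbit_graph orbit_graph.neg by blast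

text \<open>Squaring cancels the denominator \<open>y x\<close> of the slope. For
  \<open>0 < x\<close>, \<open>rpow\<close> and \<open>powr\<close> agree also when
  \<open>\<alpha> = 0\<close>.\<close>

lemma deriv_square:
  assumes "0 < x"
  shows "((\<lambda>x. (y x)\<^sup>2) has_real_derivative 2 * (c * y x + x powr \<alpha>) / \<Lambda>) (at x)"
proof -
  have "(y has_real_derivative (c * y x + x powr \<alpha>) / (\<Lambda> * y x)) (at x)"
    using ex_orbit_graph orbit_graph.deriv_y[of \<Lambda> \<alpha> c _ _ y x] assms
    by (cases "\<alpha> = 0") (auto simp: rpow_def)
  from DERIV_power[OF this, of 2]
  have "((\<lambda>x. (y x)\<^sup>2) has_real_derivative 2 * ((c * y x + x powr \<alpha>) / (\<Lambda> * y x) * y x)) (at x)"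
    by simp
  also have "(c * y x + x powr \<alpha>) / (\<Lambda> * y x) * y x = (c * y x + x powr \<alpha>) / \<Lambda>"
    using neg[OF assms] by simp
  finally show ?thesis
    by simp
qed

lemma continuous: "continuous_on {0..b} y"
proof -
  have "continuous (at x within {0..b}) y" if "x \<in> {0..b}" for x
  proof (cases "x = 0")
    case True
    have "(y \<longlongrightarrow> 0) (at_right 0)"
      using ex_orbit_graph orbit_graph.tendsto_0 by blast
    then have "(y \<longlongrightarrow> 0) (at 0 within {0..})"
      by (simp add: at_within_Ici_at_right)
    then have "(y \<longlongrightarrow> 0) (at 0 within {0..b})"
      by (rule tendsto_within_subset) auto
    then show ?thesis
      using True by (simp add: continuous_within zero)
  next
    case False
    then show ?thesis
      using that ex_orbit_graph orbit_graph.deriv_y[of \<Lambda> \<alpha> c _ _ y x]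
      by (metis DERIV_isCont atLeastAtMost_iff continuous_at_imp_continuous_at_within
          order_le_imp_less_or_eq)
  qed
  then show ?thesis
    by (simp add: continuous_on_eq_continuous_within)
qed

lemma continuous_powr: "continuous_on {0..b} (\<lambda>x. x powr (1 + \<alpha>))"
  using alpha by (intro continuous_on_powr' continuous_intros) auto

lemma deriv_powr:
  assumes "0 < x"
  shows "((\<lambda>x. x powr (1 + \<alpha>)) has_real_derivative (1 + \<alpha>) * x powr \<alpha>) (at x)"
  using has_real_derivative_powr[OF assms, of "1 + \<alpha>"] by simp

text \<open>The right-hand side solves the equation for \<open>y\<^sup>2\<close> with
  \<open>c = 0\<close>. Its difference to \<open>y\<^sup>2\<close> has derivative
  \<open>- 2 * c * y t / \<Lambda>\<close>, positive because \<open>c > 0\<close> and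
  \<open>y < 0\<close>.\<close>

lemma square_less:
  assumes "0 < c" "0 < x"
  shows "(y x)\<^sup>2 < 2 / ((1 + \<alpha>) * \<Lambda>) * x powr (1 + \<alpha>)"
proof -
  let ?h = "\<lambda>x. 2 / ((1 + \<alpha>) * \<Lambda>) * x powr (1 + \<alpha>) - (y x)\<^sup>2"
  have "?h 0 < ?h x"
  proof (rule DERIV_pos_imp_increasing_open[OF \<open>0 < x\<close>])
    fix t :: real assume t: "0 < t" "t < x"
    have "(?h has_real_derivative
        2 / ((1 + \<alpha>) * \<Lambda>) * ((1 + \<alpha>) * t powr \<alpha>) - 2 * (c * y t + t powr \<alpha>) / \<Lambda>) (at t)"
      by (intro DERIV_diff DERIV_cmult deriv_powr deriv_square t)
    also have "2 / ((1 + \<alpha>) * \<Lambda>) * ((1 + \<alpha>) * t powr \<alpha>) - 2 * (c * y t + t powr \<alpha>) / \<Lambda>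
        = - 2 * c * y t / \<Lambda>"
    proof -
      have "2 / ((1 + \<alpha>) * \<Lambda>) * ((1 + \<alpha>) * t powr \<alpha>) = 2 * t powr \<alpha> / \<Lambda>"
        using alpha by simp
      then show ?thesis
        using Lambda by (simp add: field_simps)
    qed
    finally have "(?h has_real_derivative - 2 * c * y t / \<Lambda>) (at t)" .
    moreover have "0 < - 2 * c * y t / \<Lambda>"
      using neg[OF t(1)] assms Lambda by (simp add: mult_less_0_iff divide_simps)
    ultimately show "\<exists>D. (?h has_real_derivative D) (at t) \<and> 0 < D"
      by blast
  qed (intro continuous_intros continuous_powr continuous)
  then show ?thesis
    by (simp add: zero)
qed

text \<open>Where the claim fails, \<open>- y t\<close> is below the barrier, and
  \<open>\<Lambda>\<close> times the derivative of the difference is at least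
  \<open>t powr \<alpha>\<close> times 2 minus the left-hand side of the condition on
  \<open>k\<close>. That condition makes this factor positive.\<close>

lemma square_ge:
  assumes k: "0 \<le> k" "2 * c * k * v powr ((1 - \<alpha>) / 2) + \<Lambda> * k\<^sup>2 * (1 + \<alpha>) < 2"
    and x: "x \<in> {0..v}"
  shows "k\<^sup>2 * x powr (1 + \<alpha>) \<le> (y x)\<^sup>2"
proof -
  let ?g = "\<lambda>x. (y x)\<^sup>2 - k\<^sup>2 * x powr (1 + \<alpha>)"
  have "0 \<le> ?g x"
  proof (rule nonneg_if_increasing_where_negative[of 0 v ?g x])
    fix t assume t: "0 < t" "t < v" and g: "?g t < 0"
    define D where "D = 2 * (c * y t + t powr \<alpha>) / \<Lambda> - k\<^sup>2 * ((1 + \<alpha>) * t powr \<alpha>)"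
    have "(?g has_real_derivative D) (at t)"
      unfolding D_def by (intro DERIV_diff DERIV_cmult deriv_powr deriv_square t)
    moreover have "0 < D"
    proof -
      have "(- y t)\<^sup>2 < (k * t powr ((1 + \<alpha>) / 2))\<^sup>2"
        using g by (simp add: power_mult_distrib powr_half_square)
      then have "- y t < k * t powr ((1 + \<alpha>) / 2)"
        by (rule power2_less_imp_less) (use k in simp)
      \<comment> \<open>The first factor is common to all terms of the derivative; the second is
        increasing in \<open>t\<close>, hence bounded by its value at \<open>v\<close>.\<close>
      also have "t powr ((1 + \<alpha>) / 2) = t powr \<alpha> * t powr ((1 - \<alpha>) / 2)"
      proof -
        have "(1 + \<alpha>) / 2 = \<alpha> + (1 - \<alpha>) / 2"
          by (simp add: field_simps)
        then show ?thesis
          by (simp only: powr_add)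
      qed
      also have "k * (t powr \<alpha> * t powr ((1 - \<alpha>) / 2))
          \<le> k * (t powr \<alpha> * v powr ((1 - \<alpha>) / 2))"
        using k t alpha by (intro mult_left_mono powr_mono2) auto
      finally have "c * - y t \<le> c * (k * (t powr \<alpha> * v powr ((1 - \<alpha>) / 2)))"
        using c by (intro mult_left_mono) auto
      moreover have "0 < t powr \<alpha> * (2 - 2 * c * k * v powr ((1 - \<alpha>) / 2) - \<Lambda> * k\<^sup>2 * (1 + \<alpha>))"
        using k t by (intro mult_pos_pos) auto
      ultimately have "0 < 2 * (c * y t + t powr \<alpha>) - \<Lambda> * (k\<^sup>2 * ((1 + \<alpha>) * t powr \<alpha>))"
        by (simp add: algebra_simps)
      then show ?thesis
        using Lambda by (simp add: D_def field_simps)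
    qed
    ultimately show "\<exists>D. (?g has_real_derivative D) (at t) \<and> 0 < D"
      by blast
  next
    show "continuous_on {0..v} ?g"
      by (intro continuous_intros continuous_powr continuous)
  qed (use x zero in auto)
  then show ?thesis
    by simp
qed

section \<open>Bounds for the travel time by integration\<close>

text \<open>The exponent exceeds -1 because \<open>\<alpha> < 1\<close>, so the singularity at 0 is
  integrable.\<close>

lemma has_integral_comparison:
  assumes "0 \<le> v"
  shows "((\<lambda>s. s powr - ((1 + \<alpha>) / 2)) has_integral 2 / (1 - \<alpha>) * v powr ((1 - \<alpha>) / 2)) {0..v}"
proof -
  have *: "- ((1 + \<alpha>) / 2) + 1 = (1 - \<alpha>) / 2"
    by (simp add: field_simps)
  have "- 1 < - ((1 + \<alpha>) / 2)"
    using alpha by simp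
  from has_integral_powr_from_0[OF this assms] show ?thesis
    unfolding * by (simp add: mult.commute)
qed

text \<open>The root of the barrier bounds the integrand \<open>1 / \<bar>y s\<bar>\<close> from
  above. Integrability is part of the conclusion, since the lower bound rests on it.\<close>

lemma time_upper:
  assumes v: "0 \<le> v" and k: "0 < k"
    and ge: "\<And>x. x \<in> {0..v} \<Longrightarrow> k\<^sup>2 * x powr (1 + \<alpha>) \<le> (y x)\<^sup>2"
  shows "(\<lambda>s. 1 / \<bar>y s\<bar>) integrable_on {0..v}"
    and "travel_time y v \<le> 1 / k * (2 / (1 - \<alpha>) * v powr ((1 - \<alpha>) / 2))"
proof -
  note int = has_integral_mult_right[OF has_integral_comparison[OF v], of "1 / k"]
  have le: "1 / \<bar>y s\<bar> \<le> 1 / k * s powr - ((1 + \<alpha>) / 2)" if s: "s \<in> {0..v}" for s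
  proof (cases "s = 0")
    \<comment> \<open>Both sides are 0 here, by the values of division by 0 and of
      \<open>0 powr _\<close>.\<close>
    case True
    then show ?thesis
      using zero by simp
  next
    case False
    then have "0 < s"
      using s by simp
    have "(k * s powr ((1 + \<alpha>) / 2))\<^sup>2 \<le> \<bar>y s\<bar>\<^sup>2"
      using ge[OF s] by (simp add: power_mult_distrib powr_half_square)
    then have "k * s powr ((1 + \<alpha>) / 2) \<le> \<bar>y s\<bar>"
      by (rule power2_le_imp_le) simp
    then have "1 / \<bar>y s\<bar> \<le> 1 / (k * s powr ((1 + \<alpha>) / 2))"
      using k \<open>0 < s\<close> neg[of s] by (intro divide_left_mono mult_pos_pos) auto
    also have "\<dots> = 1 / k * s powr - ((1 + \<alpha>) / 2)"
      using powr_minus_divide[of s "(1 + \<alpha>) / 2"] by simp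
    finally show ?thesis .
  qed
  show *: "(\<lambda>s. 1 / \<bar>y s\<bar>) integrable_on {0..v}"
  \<comment> \<open>The integrand is unbounded near 0, so measurability is combined with domination
    by the integrable power.\<close>
  proof (rule measurable_bounded_by_integrable_imp_integrable)
    have "y \<in> borel_measurable (lebesgue_on {0..v})"
      by (intro continuous_imp_measurable_on_sets_lebesgue continuous) auto
    then show "(\<lambda>s. 1 / \<bar>y s\<bar>) \<in> borel_measurable (lebesgue_on {0..v})"
      by measurable
    show "(\<lambda>s. 1 / k * s powr - ((1 + \<alpha>) / 2)) integrable_on {0..v}"
      using int by blast
  qed (use le in auto)
  show "travel_time y v \<le> 1 / k * (2 / (1 - \<alpha>) * v powr ((1 - \<alpha>) / 2))"
    unfolding travel_time_def
    by (rule has_integral_le[OF integrable_integral[OF *] int]) (use le in auto)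
qed

lemma time_lower:
  assumes v: "0 < v" and "0 < c" and int: "(\<lambda>s. 1 / \<bar>y s\<bar>) integrable_on {0..v}"
  shows "(2 * (1 + \<alpha>) * \<Lambda>) powr (1/2) / (1 - \<alpha>) * v powr ((1 - \<alpha>) / 2) < travel_time y v"
proof -
  \<comment> \<open>\<open>K\<^sup>2\<close> is the reciprocal of the coefficient in
    \<open>square_less\<close>.\<close>
  define K where "K = sqrt ((1 + \<alpha>) * \<Lambda> / 2)"
  let ?f = "\<lambda>s. K * s powr - ((1 + \<alpha>) / 2)" and ?g = "\<lambda>s. 1 / \<bar>y s\<bar>"
  have K: "0 < K" "K\<^sup>2 = (1 + \<alpha>) * \<Lambda> / 2"
    using alpha Lambda by (simp_all add: K_def)
  note fint = has_integral_mult_right[OF has_integral_comparison, of v K]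
  have less: "?f s < ?g s" if "0 < s" for s
  proof -
    have "(K * \<bar>y s\<bar>)\<^sup>2 < K\<^sup>2 * (2 / ((1 + \<alpha>) * \<Lambda>) * s powr (1 + \<alpha>))"
      unfolding power_mult_distrib power2_abs
      using square_less[OF \<open>0 < c\<close> that] K(1) by (intro mult_strict_left_mono) auto
    also have "\<dots> = (s powr ((1 + \<alpha>) / 2))\<^sup>2"
      using alpha Lambda by (simp add: K(2) powr_half_square)
    finally have "K * \<bar>y s\<bar> < s powr ((1 + \<alpha>) / 2)"
      by (rule power2_less_imp_less) simp
    moreover have "K / p < 1 / z" if "0 < p" "0 < z" "K * z < p" for p z
      using that by (simp add: field_simps)
    moreover have "0 < s powr ((1 + \<alpha>) / 2)" "0 < \<bar>y s\<bar>"
      using that neg[OF that] by auto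
    ultimately have "K / s powr ((1 + \<alpha>) / 2) < 1 / \<bar>y s\<bar>"
      by blast
    then show ?thesis
      by (simp add: powr_minus_divide)
  qed
  have fi: "?f integrable_on {0..v}"
    using fint v by auto
  \<comment> \<open>Strictness comes from \<open>{v/2..v}\<close>, where both integrands are
    continuous; near the singularity a weak inequality suffices.\<close>
  have sub: "?f integrable_on {0..v/2}" "?g integrable_on {0..v/2}"
    using fi int v by (auto elim: integrable_on_subinterval)
  have "integral {0..v/2} ?f \<le> integral {0..v/2} ?g"
  proof (rule integral_le[OF sub])
    show "?f s \<le> ?g s" if "s \<in> {0..v/2}" for s
      using less[of s] that zero by (cases "s = 0") auto
  qed
  moreover have "integral {v/2..v} ?f < integral {v/2..v} ?g"
  proof (rule integral_less_real)
    show "continuous_on {v/2..v} ?f"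
      using v by (intro continuous_intros) auto
    show "continuous_on {v/2..v} ?g"
    proof (intro continuous_intros continuous_on_subset[OF continuous[of v]] ballI)
      show "\<bar>y s\<bar> \<noteq> 0" if "s \<in> {v/2..v}" for s
        using that v neg[of s] by auto
    qed (use v in auto)
  qed (use less v in auto)
  ultimately have "integral {0..v} ?f < integral {0..v} ?g"
    using Henstock_Kurzweil_Integration.integral_combine[of 0 "v/2" v ?f]
      Henstock_Kurzweil_Integration.integral_combine[of 0 "v/2" v ?g] fi int v by simp
  moreover have "integral {0..v} ?f = K * (2 / (1 - \<alpha>) * v powr ((1 - \<alpha>) / 2))"
    using integral_unique[OF fint] v by (simp del: integral_mult_right)
  moreover have "(2 * (1 + \<alpha>) * \<Lambda>) powr (1/2) = 2 * K"
  proof -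
    have "sqrt (2 * (1 + \<alpha>) * \<Lambda>) = 2 * K"
      using K by (intro real_sqrt_unique) (simp_all add: power_mult_distrib algebra_simps)
    then show ?thesis
      using alpha Lambda by (simp add: powr_half_sqrt)
  qed
  ultimately show ?thesis
    by (simp add: travel_time_def mult_ac)
qed

end

section \<open>Choice of the barrier constant and comparison of the resulting constants\<close>

theorem lemma6p4:
  fixes \<Lambda> \<alpha> v0 c :: real and y :: "real \<Rightarrow> real"
  assumes "\<Lambda> > 0" and "0 \<le> \<alpha>" and "\<alpha> < 1" and "0 < v0" and "v0 < 1"
    and "c \<ge> 0"
    and "is_stable_manifold_fun \<Lambda> \<alpha> c y"
    and "y v0 = - (c / \<Lambda>) * (1 - v0)"
  shows "(2 * (1 + \<alpha>) * \<Lambda>) powr (1/2) / (1 - \<alpha>) * v0 powr ((1 - \<alpha>) / 2) < travel_time y v0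
    \<and> travel_time y v0
        < 2 * \<Lambda> powr (1/2) * A_const \<alpha> / (1 - \<alpha>) * (v0 powr ((1 - \<alpha>) / 2) / (1 - v0))"
proof -
  interpret stable_manifold \<Lambda> \<alpha> c y
    using assms by unfold_locales auto
  \<comment> \<open>With \<open>c = 0\<close> the condition at \<open>v0\<close> would give
    \<open>y v0 = 0\<close>.\<close>
  have c_pos: "0 < c"
    using neg[OF \<open>0 < v0\<close>] assms by (cases "c = 0") auto
  define k where "k = (1 - v0) * sqrt (1 + \<alpha>) / (2 * sqrt \<Lambda>)"
  have k: "0 < k" "k\<^sup>2 = (1 - v0)\<^sup>2 * (1 + \<alpha>) / (4 * \<Lambda>)"
    using assms by (simp_all add: k_def power_mult_distrib power_divide)
  \<comment> \<open>The first summand is below \<open>3/2 * v0\<close> and the second at most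
    \<open>1 - v0\<close>, so the sum is below \<open>1 + v0/2\<close>.\<close>
  have barrier: "2 * c * k * v0 powr ((1 - \<alpha>) / 2) + \<Lambda> * k\<^sup>2 * (1 + \<alpha>) < 2"
  proof -
    define w where "w = v0 powr ((1 - \<alpha>) / 2)"
    have w2: "w\<^sup>2 = v0 powr (1 - \<alpha>)"
      by (simp add: w_def powr_half_square)
    \<comment> \<open>The condition at \<open>v0\<close> turns the upper bound for
      \<open>y\<^sup>2\<close> into one for \<open>c\<close>.\<close>
    have "c\<^sup>2 * (1 - v0)\<^sup>2 = \<Lambda>\<^sup>2 * (y v0)\<^sup>2"
      using assms by (simp add: power_mult_distrib power_divide)
    also have "\<dots> < \<Lambda>\<^sup>2 * (2 / ((1 + \<alpha>) * \<Lambda>) * v0 powr (1 + \<alpha>))"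
      using square_less[OF c_pos \<open>0 < v0\<close>] \<open>0 < \<Lambda>\<close> by (intro mult_strict_left_mono) auto
    finally have c2: "c\<^sup>2 * (1 - v0)\<^sup>2 < 2 * \<Lambda> / (1 + \<alpha>) * v0 powr (1 + \<alpha>)"
      using assms by (simp add: power2_eq_square mult.left_commute mult.assoc)
    \<comment> \<open>The factor \<open>1 - v0\<close> in \<open>k\<close> is matched to the one
      accompanying \<open>c\<close>, so no negative power of \<open>1 - v0\<close> arises.\<close>
    have "(c * k * w)\<^sup>2 = (c\<^sup>2 * (1 - v0)\<^sup>2) * ((1 + \<alpha>) / (4 * \<Lambda>) * v0 powr (1 - \<alpha>))"
      by (simp add: power_mult_distrib k w2)
    also have "\<dots> < (2 * \<Lambda> / (1 + \<alpha>) * v0 powr (1 + \<alpha>)) * ((1 + \<alpha>) / (4 * \<Lambda>) * v0 powr (1 - \<alpha>))"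
      using c2 assms by (intro mult_strict_right_mono) auto
    also have "\<dots> = (v0 powr (1 + \<alpha>) * v0 powr (1 - \<alpha>)) / 2"
    proof -
      have "2 * \<Lambda> / q * a * (q / (4 * \<Lambda>) * b) = a * b / 2" if "0 < q" for q a b :: real
        using that assms by (simp add: field_simps)
      from this[of "1 + \<alpha>"] show ?thesis
        using assms by simp
    qed
    also have "v0 powr (1 + \<alpha>) * v0 powr (1 - \<alpha>) = v0\<^sup>2"
      using assms by (simp add: powr_add[symmetric])
    \<comment> \<open>3/4 is a convenient rational above the square root of 1/2.\<close>
    also have "v0\<^sup>2 / 2 \<le> (3 / 4 * v0)\<^sup>2"
      by (simp add: power_mult_distrib power_divide)
    finally have ckw: "c * k * w < 3 / 4 * v0"
      by (rule power2_less_imp_less) (use assms in simp)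
    have "\<Lambda> * k\<^sup>2 * (1 + \<alpha>) = ((1 - v0) * ((1 + \<alpha>) / 2))\<^sup>2"
      unfolding k using assms by (simp add: power2_eq_square)
    also have "\<dots> \<le> (1 - v0)\<^sup>2"
      using assms by (intro power_mono mult_left_le mult_nonneg_nonneg) auto
    also have "\<dots> \<le> 1 - v0"
      using assms by (simp add: power2_eq_square mult_left_le)
    finally show ?thesis
      using ckw assms by (simp add: w_def)
  qed
  note upper = time_upper[OF less_imp_le[OF \<open>0 < v0\<close>] k(1) square_ge[OF less_imp_le[OF k(1)] barrier]]
  have "1 / k * (2 / (1 - \<alpha>) * v0 powr ((1 - \<alpha>) / 2))
      = 2 * (2 * (sqrt \<Lambda> / sqrt (1 + \<alpha>) / (1 - \<alpha>) * (v0 powr ((1 - \<alpha>) / 2) / (1 - v0))))"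
    using assms by (simp add: k_def field_simps)
  \<comment> \<open>The barrier gives the constant 2 in place of \<open>2 powr (3/2)\<close>; this
    slack makes the upper bound strict.\<close>
  also have "\<dots> < 2 powr (3/2) * (2 * (sqrt \<Lambda> / sqrt (1 + \<alpha>) / (1 - \<alpha>) * (v0 powr ((1 - \<alpha>) / 2) / (1 - v0))))"
    using assms powr_less_mono[of 1 "3/2" "2::real"] by (intro mult_strict_right_mono) auto
  also have "\<dots> = 2 * \<Lambda> powr (1/2) * A_const \<alpha> / (1 - \<alpha>) * (v0 powr ((1 - \<alpha>) / 2) / (1 - v0))"
    using assms by (simp add: A_const_def powr_half_sqrt)
  finally show ?thesis
    using time_lower[OF \<open>0 < v0\<close> c_pos upper(1)] upper(2) by auto
qed

end
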